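(* Let $f\in\mathcal T_n$ and $g\in\mathcal T_m$ be type functions. Then the causal product $f\vartriangleleft g$ is a type function if and only if $f$ or $g$ is a chain type. If both $f$ and $g$ are chain types, then $f\vartriangleleft g$ is a chain type as well.
   Context: Notation. $[n]=\{1,\dots,n\}$; $\theta=\theta_n\in\{0,1\}^n$ is the zero string. $\mathcal F_n=\{f:\{0,1\}^n\to\{0,1\} : f(\theta)=1\}$; $p_n\in\mathcal F_n$ is the indicator function of $\{\theta\}$, $1_n$ the constant function $1$, and $f^*=1-f+p_n$. For $T\subseteq[n]$, $p_T(s)=\prod_{i\in T}(1-s_i)$. For $f\in\mathcal F_n$, $g\in\mathcal F_m$, $(f\otimes g)(s^1s^2)=f(s^1)g(s^2)$, where $s^1\in\{0,1\}^n$, $s^2\in\{0,1\}^m$ and $s^1s^2$ is the concatenation. A permutation $\sigma$ of $[n]$ acts on strings by $\sigma(s)=s_{\sigma^{-1}(1)}\dots s_{\sigma^{-1}(n)}$. The sets $\mathcal T_n\subseteq\mathcal F_n$ ($n\ge1$) of type functions form the smallest family with $1_1\in\mathcal T_1$ closed under $f\mapsto f^*$, $f\mapsto f\circ\sigma$ (all permutations), and $(f,g)\mapsto f\otimes g$. A type function $f\in\mathcal T_n$ is a chain type if there are sets $S_0\subsetneq\dots\subsetneq S_N\subseteq[n]$ with $N$ even such that $f=\sum_{i=0}^N(-1)^ip_{S_i}$. Causal product. For $f\in\mathcal F_n$, $g\in\mathcal F_m$, $f\vartriangleleft g\in\mathcal F_{n+m}$ is $f\vartriangleleft g=(f-p_n)\otimes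 1_m+p_n\otimes g$, i.e. $(f\vartriangleleft g)(s^1s^2)=f(s^1)$ if $s^1\ne\theta_n$ and $=g(s^2)$ if $s^1=\theta_n$. *)

theory Defs
  imports "HOL-Combinatorics.Permutations" "HOL-Library.FuncSet"
begin

text \<open>Bits are booleans (\<open>True\<close> is 1), a string in \<open>{0,1}\<^sup>n\<close> is a list of length \<open>n\<close>, and positions
  are counted from 0, so \<open>[n]\<close> is rendered as \<open>{..<n}\<close>. Functions on \<open>{0,1}\<^sup>n\<close> are
  integer valued, so that sums and differences can be formed before one knows that the result is 0 or 1,
  and extensional (undefined outside \<open>strings n\<close>), so that HOL equality
  is equality of functions on \<open>{0,1}\<^sup>n\<close>.\<close>

definition strings :: "nat \<Rightarrow> bool list set" where
  "strings n = {s. length s = n}"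

definition zero_string :: "nat \<Rightarrow> bool list" where
  "zero_string n = replicate n False"

definition bool_funs :: "nat \<Rightarrow> (bool list \<Rightarrow> int) set" where
  "bool_funs n = {f \<in> strings n \<rightarrow>\<^sub>E {0, 1}. f (zero_string n) = 1}"

definition point_fun :: "nat \<Rightarrow> bool list \<Rightarrow> int" where
  "point_fun n = (\<lambda>s\<in>strings n. of_bool (s = zero_string n))"

definition one_fun :: "nat \<Rightarrow> bool list \<Rightarrow> int" where
  "one_fun n = (\<lambda>s\<in>strings n. 1)"

definition dual_fun :: "nat \<Rightarrow> (bool list \<Rightarrow> int) \<Rightarrow> bool list \<Rightarrow> int" where
  "dual_fun n f = (\<lambda>s\<in>strings n. 1 - f s + point_fun n s)"

definition subset_fun :: "nat set \<Rightarrow> bool list \<Rightarrow> int" where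
  "subset_fun T s = (\<Prod>i\<in>T. 1 - of_bool (s ! i))"

definition tensor_fun ::
  "nat \<Rightarrow> nat \<Rightarrow> (bool list \<Rightarrow> int) \<Rightarrow> (bool list \<Rightarrow> int) \<Rightarrow> bool list \<Rightarrow> int" where
  "tensor_fun n m f g = (\<lambda>s\<in>strings (n + m). f (take n s) * g (drop n s))"

text \<open>As \<open>permute_list \<pi> s\<close> has \<open>s ! \<pi> i\<close> at position \<open>i\<close>, the action that puts the bit at position
  \<open>inv \<sigma> i\<close> of \<open>s\<close> at position \<open>i\<close> is \<open>permute_list (inv \<sigma>)\<close>.\<close>

definition perm_fun :: "nat \<Rightarrow> (nat \<Rightarrow> nat) \<Rightarrow> (bool list \<Rightarrow> int) \<Rightarrow> bool list \<Rightarrow> int" where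
  "perm_fun n \<sigma> f = (\<lambda>s\<in>strings n. f (permute_list (inv \<sigma>) s))"

inductive type_fun :: "nat \<Rightarrow> (bool list \<Rightarrow> int) \<Rightarrow> bool" where
  one: "type_fun 1 (one_fun 1)"
| dual: "type_fun n f \<Longrightarrow> type_fun n (dual_fun n f)"
| perm: "type_fun n f \<Longrightarrow> \<sigma> permutes {..<n} \<Longrightarrow> type_fun n (perm_fun n \<sigma> f)"
| tensor: "type_fun n f \<Longrightarrow> type_fun m g \<Longrightarrow> type_fun (n + m) (tensor_fun n m f g)"

definition chain_type :: "nat \<Rightarrow> (bool list \<Rightarrow> int) \<Rightarrow> bool" where
  "chain_type n f \<longleftrightarrow> type_fun n f \<and>
     (\<exists>N S. even N \<and> (\<forall>i<N. S i \<subset> S (Suc i)) \<and> S N \<subseteq> {..<n} \<and>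
        f = (\<lambda>s\<in>strings n. \<Sum>i\<le>N. (- 1) ^ i * subset_fun (S i) s))"

definition causal_prod ::
  "nat \<Rightarrow> nat \<Rightarrow> (bool list \<Rightarrow> int) \<Rightarrow> (bool list \<Rightarrow> int) \<Rightarrow> bool list \<Rightarrow> int" where
  "causal_prod n m f g = (\<lambda>s\<in>strings (n + m).
     tensor_fun n m (\<lambda>t. f t - point_fun n t) (one_fun m) s + tensor_fun n m (point_fun n) g s)"

lemma causal_prod_append:
  assumes "f \<in> bool_funs n" "s \<in> strings n" "t \<in> strings m"
  shows "causal_prod n m f g (s @ t) = (if s = zero_string n then g t else f s)"
  using assms
  by (auto simp: causal_prod_def tensor_fun_def one_fun_def point_fun_def strings_def bool_funs_def)

lemma subset_fun_all:
  assumes "s \<in> strings n"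
  shows "subset_fun {..<n} s = point_fun n s"
proof (cases "s = zero_string n")
  case True
  then show ?thesis using assms by (auto simp: subset_fun_def point_fun_def zero_string_def)
next
  case False
  then obtain i where "i < n" "s ! i"
    using assms by (auto simp: strings_def zero_string_def list_eq_iff_nth_eq)
  then have "subset_fun {..<n} s = 0" by (auto simp: subset_fun_def intro!: prod_zero)
  then show ?thesis using False assms by (simp add: point_fun_def)
qed

lemma restrict_in_bool_funs:
  assumes "\<And>s. s \<in> strings n \<Longrightarrow> h s = 0 \<or> h s = 1" "h (zero_string n) = 1"
  shows "restrict h (strings n) \<in> bool_funs n"
  using assms by (auto simp: bool_funs_def strings_def zero_string_def)

lemma type_fun_bool_funs: "type_fun n f \<Longrightarrow> f \<in> bool_funs n"
proof (induction rule: type_fun.induct)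
  case one
  then show ?case unfolding one_fun_def by (rule restrict_in_bool_funs) auto
next
  case (dual n f)
  then have "f s = 0 \<or> f s = 1" if "s \<in> strings n" for s
    using that by (auto simp: bool_funs_def)
  with dual show ?case unfolding dual_fun_def
    by (intro restrict_in_bool_funs)
      (fastforce simp: bool_funs_def point_fun_def strings_def zero_string_def)+
next
  case (perm n f \<sigma>)
  have z: "permute_list (inv \<sigma>) (zero_string n) = zero_string n"
    using permutes_in_image[OF permutes_inv[OF perm(2)]]
    by (auto simp: list_eq_iff_nth_eq zero_string_def permute_list_def)
  have "f (permute_list (inv \<sigma>) s) = 0 \<or> f (permute_list (inv \<sigma>) s) = 1" if "s \<in> strings n" for s
    using that perm.IH by (auto simp: bool_funs_def strings_def)
  with z perm.IH show ?case unfolding perm_fun_def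
    by (intro restrict_in_bool_funs) (auto simp: bool_funs_def)
next
  case (tensor n f m g)
  have "f (take n s) * g (drop n s) = 0 \<or> f (take n s) * g (drop n s) = 1"
    if "s \<in> strings (n + m)" for s
  proof -
    have "take n s \<in> strings n" "drop n s \<in> strings m" using that by (auto simp: strings_def)
    then have "f (take n s) \<in> {0, 1}" "g (drop n s) \<in> {0, 1}"
      using tensor.IH by (auto simp: bool_funs_def)
    then show ?thesis by auto
  qed
  with tensor.IH show ?case unfolding tensor_fun_def
    by (intro restrict_in_bool_funs) (auto simp: bool_funs_def zero_string_def)
qed

lemma type_fun_pos: "type_fun n f \<Longrightarrow> n \<ge> 1"
  by (induction rule: type_fun.induct) auto

end

theory Submission
  imports Defs
begin

text \<open>Chain functions are the functions for which there is a rank on the positions such that the value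
  at a nonzero string is the parity of the smallest rank of a position carrying a 1; the sets of
  the chain are the sublevel sets of the rank. If \<open>f\<close> is ranked, sort the positions by rank and peel off
  the lowest one: up to duality, \<open>f = p\<^sub>1 \<otimes> f'\<close> and then \<open>f \<lhd> g = p\<^sub>1 \<otimes> (f' \<lhd> g)\<close>, where
  \<open>(f \<lhd> g)\<^sup>* = f\<^sup>* \<lhd> g\<^sup>*\<close> disposes of the other parity. If \<open>g\<close> is ranked, peel off its highest position.

  For the converse, say that \<open>a\<close> beats \<open>b\<close> if the strings supported at \<open>a\<close> and at \<open>b\<close> have different
  values and the string supported at \<open>{a, b}\<close> has the value of \<open>a\<close>. This relation is invariant under
  duality. A type function that is not ranked has a cycle of length 4 for it. If neither \<open>f\<close> nor \<open>g\<close>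
  is ranked, every position in a cycle of \<open>f\<close> beats in \<open>f \<lhd> g\<close> every position of
  different value in a cycle of \<open>g\<close>. No type function contains such a stacked pair of cycles: in a
  tensor product a position of value 1 never beats one of the other factor, which forces all eight
  positions into the same factor.\<close>

section \<open>Boolean functions\<close>

lemma mem_strings [simp]: "s \<in> strings n \<longleftrightarrow> length s = n"
  by (simp add: strings_def)

lemma length_zero_string [simp]: "length (zero_string n) = n"
  by (simp add: zero_string_def)

lemma eq_zero_string_iff: "length s = n \<Longrightarrow> s = zero_string n \<longleftrightarrow> (\<forall>i<n. \<not> s ! i)"
  by (auto simp: zero_string_def list_eq_iff_nth_eq)

lemma append_eq_zero_string_iff:
  "length s = n \<Longrightarrow> s @ t = zero_string (n + m) \<longleftrightarrow> s = zero_string n \<and> t = zero_string m"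
  by (simp add: zero_string_def replicate_add append_eq_append_conv)

lemma bool_fun_01: "f \<in> bool_funs n \<Longrightarrow> length s = n \<Longrightarrow> f s = 0 \<or> f s = 1"
  by (auto simp: bool_funs_def)

lemma bool_fun_zero: "f \<in> bool_funs n \<Longrightarrow> f (zero_string n) = 1"
  by (simp add: bool_funs_def)

lemma bool_fun_ext: "f \<in> bool_funs n \<Longrightarrow> length s \<noteq> n \<Longrightarrow> f s = undefined"
  by (force simp: bool_funs_def PiE_def extensional_def)

lemma bool_fun_eqI:
  assumes "f \<in> bool_funs n" "\<And>s. length s = n \<Longrightarrow> f s = g s"
    "\<And>s. length s \<noteq> n \<Longrightarrow> g s = undefined"
  shows "f = g"
  by (rule ext) (metis assms bool_fun_ext)

lemma dual_fun_apply:
  "length s = n \<Longrightarrow> dual_fun n f s = (if s = zero_string n then 2 - f s else 1 - f s)"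
  by (simp add: dual_fun_def point_fun_def)

lemma dual_fun_in_bool_funs: "f \<in> bool_funs n \<Longrightarrow> dual_fun n f \<in> bool_funs n"
  unfolding dual_fun_def
  by (rule restrict_in_bool_funs)
    (auto simp: point_fun_def bool_fun_zero dest: bool_fun_01)

lemma dual_dual_fun: "f \<in> bool_funs n \<Longrightarrow> dual_fun n (dual_fun n f) = f"
  by (rule bool_fun_eqI[of _ n, symmetric])
    (auto simp: dual_fun_apply dual_fun_in_bool_funs, simp add: dual_fun_def)

lemma tensor_fun_append:
  "length s = n \<Longrightarrow> length t = m \<Longrightarrow> tensor_fun n m f g (s @ t) = f s * g t"
  by (simp add: tensor_fun_def)

lemma tensor_fun_in_bool_funs:
  assumes "f \<in> bool_funs n" "g \<in> bool_funs m"
  shows "tensor_fun n m f g \<in> bool_funs (n + m)"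
  unfolding tensor_fun_def
proof (rule restrict_in_bool_funs)
  show "f (take n s) * g (drop n s) = 0 \<or> f (take n s) * g (drop n s) = 1"
    if "s \<in> strings (n + m)" for s
    using bool_fun_01[OF assms(1), of "take n s"] bool_fun_01[OF assms(2), of "drop n s"] that
    by auto
  show "f (take n (zero_string (n + m))) * g (drop n (zero_string (n + m))) = 1"
    using assms by (simp add: bool_funs_def zero_string_def)
qed

lemma causal_prod_in_bool_funs:
  assumes "f \<in> bool_funs n" "g \<in> bool_funs m"
  shows "causal_prod n m f g \<in> bool_funs (n + m)"
proof -
  have app: "causal_prod n m f g s
      = (if take n s = zero_string n then g (drop n s) else f (take n s))"
    if "s \<in> strings (n + m)" for s
    using causal_prod_append[OF assms(1), of "take n s" "drop n s" m g] that by simp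
  have "restrict (causal_prod n m f g) (strings (n + m)) \<in> bool_funs (n + m)"
  proof (rule restrict_in_bool_funs)
    show "causal_prod n m f g s = 0 \<or> causal_prod n m f g s = 1" if "s \<in> strings (n + m)" for s
      using bool_fun_01[OF assms(1), of "take n s"] bool_fun_01[OF assms(2), of "drop n s"] that
      by (simp add: app)
    show "causal_prod n m f g (zero_string (n + m)) = 1"
      using assms by (subst app) (simp_all add: bool_funs_def zero_string_def)
  qed
  moreover have "restrict (causal_prod n m f g) (strings (n + m)) = causal_prod n m f g"
    by (simp add: causal_prod_def)
  ultimately show ?thesis by simp
qed

text \<open>Every string of length \<open>n + m\<close> splits into a prefix and a suffix, so
  checking values on \<open>s @ t\<close> suffices. All later identities that rewrite a causal
  product as another function use this.\<close>

lemma causal_prod_eqI: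
  assumes "f \<in> bool_funs n" "g \<in> bool_funs m"
    and "\<And>s t. length s = n \<Longrightarrow> length t = m \<Longrightarrow> h (s @ t) = (if s = zero_string n then g t else f s)"
    and "\<And>s. length s \<noteq> n + m \<Longrightarrow> h s = undefined"
  shows "causal_prod n m f g = h"
proof (rule bool_fun_eqI[OF causal_prod_in_bool_funs[OF assms(1,2)]])
  fix s :: "bool list" assume s: "length s = n + m"
  then have "length (take n s) = n" "length (drop n s) = m" by simp_all
  then have "causal_prod n m f g (take n s @ drop n s) = h (take n s @ drop n s)"
    using causal_prod_append[OF assms(1), of "take n s" "drop n s" m g]
      assms(3)[of "take n s" "drop n s"] by simp
  then show "causal_prod n m f g s = h s" by simp
qed (use assms(4) in auto)

text \<open>Which factor is read depends only on whether the prefix is zero. Duality flips values at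
  nonzero strings, so it passes into the factor being read; at the zero string both sides are
  1.\<close>

lemma dual_causal_prod:
  assumes "f \<in> bool_funs n" "g \<in> bool_funs m"
  shows "dual_fun (n + m) (causal_prod n m f g) = causal_prod n m (dual_fun n f) (dual_fun m g)"
proof (rule causal_prod_eqI[symmetric])
  fix s t :: "bool list" assume "length s = n" "length t = m"
  then show "dual_fun (n + m) (causal_prod n m f g) (s @ t)
      = (if s = zero_string n then dual_fun m g t else dual_fun n f s)"
    using causal_prod_append[OF assms(1), of s t m g]
    by (auto simp: dual_fun_apply append_eq_zero_string_iff split: if_splits)
qed (auto simp: assms dual_fun_in_bool_funs, simp add: dual_fun_def)

text \<open>The rule \<open>perm\<close> precomposes with \<open>inv \<sigma>\<close>; feeding it
  the inverse permutation gives a form in which \<open>\<sigma>\<close> itself rearranges the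
  string.\<close>

lemma type_fun_permute:
  assumes "type_fun n f" "\<sigma> permutes {..<n}"
  shows "type_fun n (\<lambda>s\<in>strings n. f (permute_list \<sigma> s))"
  using type_fun.perm[OF assms(1) permutes_inv[OF assms(2)]]
  by (simp add: perm_fun_def permutes_inv_inv[OF assms(2)])

section \<open>Ranked functions\<close>

text \<open>Ties and gaps among the ranks are allowed. The zero string has no minimal position, so
  its value is left to \<open>bool_funs\<close>.\<close>

definition ranked :: "nat \<Rightarrow> (bool list \<Rightarrow> int) \<Rightarrow> (nat \<Rightarrow> nat) \<Rightarrow> bool" where
  "ranked n f r \<longleftrightarrow> (\<forall>s j. length s = n \<longrightarrow> j < n \<longrightarrow> s ! j \<longrightarrow>
     (\<forall>k<n. s ! k \<longrightarrow> r j \<le> r k) \<longrightarrow> f s = of_bool (odd (r j)))"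

lemma rankedD:
  assumes "ranked n f r" "length s = n" "j < n" "s ! j" "\<And>k. k < n \<Longrightarrow> s ! k \<Longrightarrow> r j \<le> r k"
  shows "f s = of_bool (odd (r j))"
  using assms unfolding ranked_def by blast

lemma obtain_min_rank:
  fixes r :: "nat \<Rightarrow> nat"
  assumes "length s = n" "s \<noteq> zero_string n"
  obtains j where "j < n" "s ! j" "\<And>k. k < n \<Longrightarrow> s ! k \<Longrightarrow> r j \<le> r k"
proof -
  obtain i where "i < n \<and> s ! i" using assms by (auto simp: eq_zero_string_iff)
  from ex_has_least_nat[of "\<lambda>i. i < n \<and> s ! i", OF this, of r] that show ?thesis by blast
qed

text \<open>A position minimal for \<open>r\<close> is also minimal for \<open>r'\<close> by
  monotonicity, so both minima have the same rank under \<open>r'\<close> and hence the same parity.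
  This permits merging levels.\<close>

lemma ranked_coarsen:
  assumes f: "ranked n f r"
    and mono: "\<And>j k. j < n \<Longrightarrow> k < n \<Longrightarrow> r j \<le> r k \<Longrightarrow> r' j \<le> r' k"
    and parity: "\<And>j. j < n \<Longrightarrow> odd (r' j) \<longleftrightarrow> odd (r j)"
  shows "ranked n f r'"
  unfolding ranked_def
proof (intro allI impI)
  fix s :: "bool list" and j
  assume s: "length s = n" and j: "j < n" "s ! j" and min: "\<forall>k<n. s ! k \<longrightarrow> r' j \<le> r' k"
  have "s \<noteq> zero_string n" using s j eq_zero_string_iff by blast
  then obtain i where i: "i < n" "s ! i" "\<And>k. k < n \<Longrightarrow> s ! k \<Longrightarrow> r i \<le> r k"
    using obtain_min_rank s by metis
  then have "r' i = r' j" using min mono j by (meson le_antisym)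
  then have "odd (r i) \<longleftrightarrow> odd (r' j)" using parity i(1) by metis
  then show "f s = of_bool (odd (r' j))" using rankedD[OF f s i] by simp
qed

lemma ranked_one: "ranked 1 (one_fun 1) (\<lambda>_. 1)"
  by (simp add: ranked_def one_fun_def)

text \<open>Raising all ranks by one preserves minima and flips parities, just as duality flips
  values at nonzero strings.\<close>

lemma ranked_dual: "ranked n f r \<Longrightarrow> ranked n (dual_fun n f) (\<lambda>i. Suc (r i))"
  unfolding ranked_def by (auto simp: dual_fun_apply eq_zero_string_iff)

lemma ranked_permute:
  assumes "ranked n f r" and p: "\<sigma> permutes {..<n}"
  shows "ranked n (\<lambda>s\<in>strings n. f (permute_list \<sigma> s)) (\<lambda>i. r (inv \<sigma> i))"
  unfolding ranked_def
proof (intro allI impI)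
  fix s :: "bool list" and j
  assume s: "length s = n" and j: "j < n" "s ! j"
    and min: "\<forall>k<n. s ! k \<longrightarrow> r (inv \<sigma> j) \<le> r (inv \<sigma> k)"
  have ps: "\<sigma> permutes {..<length s}" using p s by simp
  have lt: "\<sigma> i < n \<longleftrightarrow> i < n" "inv \<sigma> i < n \<longleftrightarrow> i < n" for i
    using permutes_in_image[OF p, of i] permutes_in_image[OF permutes_inv[OF p], of i] by simp_all
  have "f (permute_list \<sigma> s) = of_bool (odd (r (inv \<sigma> j)))"
  proof (rule rankedD[OF assms(1)])
    show "permute_list \<sigma> s ! inv \<sigma> j"
      using j s lt by (simp add: permute_list_nth[OF ps] permutes_inverses[OF p])
    show "r (inv \<sigma> j) \<le> r k" if "k < n" "permute_list \<sigma> s ! k" for k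
      using min[rule_format, of "\<sigma> k"] that s lt
      by (simp add: permute_list_nth[OF ps] permutes_inverses[OF p])
  qed (use s j lt in simp_all)
  then show "(\<lambda>s\<in>strings n. f (permute_list \<sigma> s)) s = of_bool (odd (r (inv \<sigma> j)))"
    using s by simp
qed

text \<open>All ranks of \<open>g\<close> are placed above those of \<open>f\<close>, so a 1 in the
  prefix always takes precedence.\<close>

lemma ranked_causal_prod:
  assumes f: "f \<in> bool_funs n" and rf: "ranked n f r" and rg: "ranked m g q"
  shows "\<exists>r'. ranked (n + m) (causal_prod n m f g) r'"
proof -
  obtain K where K: "\<And>i. i < n \<Longrightarrow> r i < K"
    using finite_nat_set_iff_bounded[of "r ` {..<n}"] by auto
  \<comment> \<open>The offset is even, to preserve parities, and at least the bound
    \<open>K\<close> on the ranks of \<open>f\<close>.\<close>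
  define r' where "r' i = (if i < n then r i else 2 * K + q (i - n))" for i
  have "ranked (n + m) (causal_prod n m f g) r'"
    unfolding ranked_def
  proof (intro allI impI)
    fix s :: "bool list" and j
    assume s: "length s = n + m" and j: "j < n + m" "s ! j"
      and min: "\<forall>k<n + m. s ! k \<longrightarrow> r' j \<le> r' k"
    have cp: "causal_prod n m f g s
        = (if take n s = zero_string n then g (drop n s) else f (take n s))"
      using causal_prod_append[OF f, of "take n s" "drop n s" m g] s by simp
    show "causal_prod n m f g s = of_bool (odd (r' j))"
    proof (cases "take n s = zero_string n")
      case True
      then have none: "\<not> s ! k" if "k < n" for k
        using that s eq_zero_string_iff[of "take n s" n] by simp
      then have "n \<le> j" using j not_less by blast
      have "g (drop n s) = of_bool (odd (q (j - n)))"
      proof (rule rankedD[OF rg])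
        show "q (j - n) \<le> q k" if "k < m" "drop n s ! k" for k
          using min[rule_format, of "n + k"] that s \<open>n \<le> j\<close> by (simp add: r'_def)
      qed (use s j \<open>n \<le> j\<close> in auto)
      then show ?thesis using cp True \<open>n \<le> j\<close> by (simp add: r'_def)
    next
      case False
      then obtain i where i: "i < n" "s ! i"
        using s eq_zero_string_iff[of "take n s" n] by auto
      then have "r' j < K" using min[rule_format, of i] K[of i] s by (simp add: r'_def)
      then have "j < n" by (auto simp: r'_def split: if_splits)
      have "f (take n s) = of_bool (odd (r j))"
      proof (rule rankedD[OF rf])
        show "r j \<le> r k" if "k < n" "take n s ! k" for k
          using min[rule_format, of k] that s \<open>j < n\<close> by (simp add: r'_def)
      qed (use s j \<open>j < n\<close> in auto)
      then show ?thesis using cp False \<open>j < n\<close> by (simp add: r'_def)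
    qed
  qed
  then show ?thesis by blast
qed

section \<open>Ranked functions and alternating sums\<close>

lemma sum_alternating: "(\<Sum>i<k. (- 1) ^ i) = (of_bool (odd k) :: int)"
  by (induction k) auto

lemma subset_fun_eq: "finite T \<Longrightarrow> subset_fun T s = of_bool (\<forall>i\<in>T. \<not> s ! i)"
  unfolding subset_fun_def by (induction T rule: finite_induct) auto

text \<open>The term of \<open>S i\<close> survives at \<open>s\<close> exactly when
  \<open>i\<close> is below the minimal rank of a 1 in \<open>s\<close>, so the sum is an
  alternating sum of that many signs. Rank \<open>Suc N\<close> is for positions in none of the
  sets.\<close>

lemma alternating_sum_ranked:
  assumes lev: "\<And>i j. i \<le> N \<Longrightarrow> j < n \<Longrightarrow> j \<in> S i \<longleftrightarrow> r j \<le> i"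
    and sub: "\<And>i. i \<le> N \<Longrightarrow> S i \<subseteq> {..<n}"
    and le: "\<And>j. j < n \<Longrightarrow> r j \<le> Suc N"
  shows "ranked n (\<lambda>s. \<Sum>i\<le>N. (- 1) ^ i * subset_fun (S i) s) r"
  unfolding ranked_def
proof (intro allI impI)
  fix s :: "bool list" and j
  assume s: "length s = n" and j: "j < n" "s ! j" and min: "\<forall>k<n. s ! k \<longrightarrow> r j \<le> r k"
  have "subset_fun (S i) s = of_bool (i < r j)" if "i \<le> N" for i
  proof -
    have "(\<forall>k\<in>S i. \<not> s ! k) \<longleftrightarrow> i < r j"
      using lev[OF that] sub[OF that] min j by (meson lessThan_iff not_less order_trans subsetD)
    moreover have "finite (S i)" using sub[OF that] finite_subset by blast
    ultimately show ?thesis by (simp add: subset_fun_eq)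
  qed
  then have "(\<Sum>i\<le>N. (- 1) ^ i * subset_fun (S i) s) = (\<Sum>i\<le>N. if i < r j then (- 1) ^ i else 0)"
    by (intro sum.cong) auto
  also have "\<dots> = (\<Sum>i<r j. (- 1) ^ i)"
    using le[OF j(1)] by (intro sum.mono_neutral_cong_right) auto
  finally show "(\<Sum>i\<le>N. (- 1) ^ i * subset_fun (S i) s) = of_bool (odd (r j))"
    by (simp add: sum_alternating)
qed

lemma chain_type_imp_ranked:
  assumes "chain_type n f"
  shows "\<exists>r. ranked n f r"
proof -
  from assms obtain N S where S: "\<And>i. i < N \<Longrightarrow> S i \<subset> S (Suc i)" "S N \<subseteq> {..<n}"
    and f: "f = (\<lambda>s\<in>strings n. \<Sum>i\<le>N. (- 1) ^ i * subset_fun (S i) s)"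
    unfolding chain_type_def by auto
  have mono: "S i \<subseteq> S k" if "i \<le> k" "k \<le> N" for i k
    using that
  proof (induction k)
    case (Suc k)
    then show ?case using S(1)[of k] by (cases "i = Suc k") auto
  qed simp
  \<comment> \<open>The rank is the index of the first set containing \<open>j\<close>; the default
    \<open>Suc N\<close> lies just beyond the chain.\<close>
  define r where "r j = (LEAST i. i = Suc N \<or> j \<in> S i)" for j
  have hit: "r j = Suc N \<or> j \<in> S (r j)" for j
    unfolding r_def by (rule LeastI[of _ "Suc N"]) simp
  have le: "r j \<le> Suc N" for j unfolding r_def by (rule Least_le) simp
  have "j \<in> S i \<longleftrightarrow> r j \<le> i" if "i \<le> N" for i j
  proof
    show "r j \<le> i" if "j \<in> S i" unfolding r_def using that by (intro Least_le) simp
    show "j \<in> S i" if "r j \<le> i" using that hit[of j] mono[of "r j" i] \<open>i \<le> N\<close> by auto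
  qed
  then have "ranked n (\<lambda>s. \<Sum>i\<le>N. (- 1) ^ i * subset_fun (S i) s) r"
    using le mono S(2) by (intro alternating_sum_ranked) blast+
  then have "ranked n f r" unfolding f ranked_def by simp
  then show ?thesis by blast
qed

lemma ranked_imp_chain_type:
  assumes f: "type_fun n f" and "ranked n f r"
  shows "chain_type n f"
proof -
  txt \<open>A rank with the least possible number of levels takes every intermediate value: otherwise the
    two levels around a missing one have equal parity and can be merged. Hence its sublevel sets increase strictly.\<close>
  define P where "P N \<longleftrightarrow> even N \<and> (\<exists>r. ranked n f r \<and> (\<forall>j<n. r j \<le> Suc N))" for N
  obtain K where "\<And>j. j < n \<Longrightarrow> r j < K"
    using finite_nat_set_iff_bounded[of "r ` {..<n}"] by auto
  \<comment> \<open>Doubling the bound yields an even candidate for \<open>N\<close>, as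
    \<open>P\<close> demands.\<close>
  then have "r j \<le> Suc (2 * K)" if "j < n" for j using that by (fastforce dest: less_imp_le)
  then have "P (2 * K)" unfolding P_def using assms(2) by auto
  define N where "N = (LEAST N. P N)"
  have "P N" unfolding N_def by (rule LeastI) fact
  then obtain q where N: "even N" and q: "ranked n f q" and le: "\<And>j. j < n \<Longrightarrow> q j \<le> Suc N"
    unfolding P_def by auto
  define S where "S i = {j. j < n \<and> q j \<le> i}" for i
  have strict: "S i \<subset> S (Suc i)" if "i < N" for i
  proof -
    have "\<exists>j<n. q j = Suc i"
    proof (rule ccontr)
      assume no: "\<not> (\<exists>j<n. q j = Suc i)"
      \<comment> \<open>With level \<open>Suc i\<close> empty, every rank above \<open>i\<close> is
        at least \<open>i + 2\<close>. Lowering it by two preserves parity and order and merges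
        level \<open>i + 2\<close> into level \<open>i\<close>.\<close>
      define q' where "q' j = (if q j \<le> i then q j else q j - 2)" for j
      have "ranked n f q'"
        by (rule ranked_coarsen[OF q]) (use no in \<open>force simp: q'_def\<close>)+
      \<comment> \<open>An even \<open>N\<close> above \<open>i\<close> is at least 2, so
        \<open>Suc (N - 2)\<close> is \<open>N - 1\<close>, which also bounds the ranks left
        unchanged.\<close>
      moreover have "q' j \<le> Suc (N - 2)" if "j < n" for j
        using le[OF that] \<open>i < N\<close> N unfolding q'_def by presburger
      ultimately have "P (N - 2)" unfolding P_def using N by auto
      then have "N \<le> N - 2" unfolding N_def by (rule Least_le)
      then show False using \<open>i < N\<close> N by presburger
    qed
    then obtain j where "j < n" "q j = Suc i" by blast
    then have "j \<in> S (Suc i)" "j \<notin> S i" by (simp_all add: S_def)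
    moreover have "S i \<subseteq> S (Suc i)" by (auto simp: S_def)
    ultimately show ?thesis by blast
  qed
  have rk: "ranked n (\<lambda>s. \<Sum>i\<le>N. (- 1) ^ i * subset_fun (S i) s) q"
    by (rule alternating_sum_ranked) (use le in \<open>auto simp: S_def\<close>)
  have "f = (\<lambda>s\<in>strings n. \<Sum>i\<le>N. (- 1) ^ i * subset_fun (S i) s)"
  proof (rule bool_fun_eqI[OF type_fun_bool_funs[OF f]])
    fix s :: "bool list" assume s: "length s = n"
    show "f s = (\<lambda>s\<in>strings n. \<Sum>i\<le>N. (- 1) ^ i * subset_fun (S i) s) s"
    proof (cases "s = zero_string n")
      case True
      have fin: "finite (S i)" for i unfolding S_def by simp
      have "subset_fun (S i) s = 1" for i
      proof -
        have "\<forall>k\<in>S i. \<not> s ! k" using True s eq_zero_string_iff[of s n] by (auto simp: S_def)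
        then show ?thesis by (simp add: subset_fun_eq[OF fin])
      qed
      \<comment> \<open>All \<open>N + 1\<close> signs survive at the zero string, an odd number
        because \<open>N\<close> is even.\<close>
      then have "(\<Sum>i\<le>N. (- 1) ^ i * subset_fun (S i) s) = 1"
        using sum_alternating[of "Suc N"] N by (simp add: lessThan_Suc_atMost)
      then show ?thesis using True bool_fun_zero[OF type_fun_bool_funs[OF f]] by simp
    next
      case False
      then obtain j where "j < n" "s ! j" "\<And>k. k < n \<Longrightarrow> s ! k \<Longrightarrow> q j \<le> q k"
        using obtain_min_rank s by metis
      then show ?thesis using rankedD[OF q s] rankedD[OF rk s] s by simp
    qed
  qed simp
  moreover have "S N \<subseteq> {..<n}" unfolding S_def by auto
  ultimately show ?thesis unfolding chain_type_def using f N strict by blast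
qed

section \<open>Permutations of positions\<close>

lemma permute_list_append_left:
  assumes "\<sigma> permutes {..<length s}"
  shows "permute_list \<sigma> (s @ t) = permute_list \<sigma> s @ t"
proof (rule nth_equalityI)
  fix i assume "i < length (permute_list \<sigma> (s @ t))"
  then show "permute_list \<sigma> (s @ t) ! i = (permute_list \<sigma> s @ t) ! i"
    using permutes_in_image[OF assms, of i] permutes_not_in[OF assms, of i]
    by (auto simp: permute_list_def nth_append)
qed simp

definition shift_perm :: "nat \<Rightarrow> (nat \<Rightarrow> nat) \<Rightarrow> nat \<Rightarrow> nat" where
  "shift_perm n \<sigma> i = (if i < n then i else n + \<sigma> (i - n))"

lemma shift_perm_permutes:
  assumes "\<sigma> permutes {..<m}"
  shows "shift_perm n \<sigma> permutes {..<n + m}"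
proof (rule inj_imp_permutes)
  show "inj_on (shift_perm n \<sigma>) {..<n + m}"
    using inj_eq[OF permutes_inj[OF assms]] by (auto simp: inj_on_def shift_perm_def)
  show "shift_perm n \<sigma> i \<in> {..<n + m}" if "i \<in> {..<n + m}" for i
    using that permutes_in_image[OF assms, of "i - n"] by (auto simp: shift_perm_def)
  show "shift_perm n \<sigma> i = i" if "i \<notin> {..<n + m}" for i
    using that permutes_not_in[OF assms, of "i - n"] by (auto simp: shift_perm_def)
qed simp

lemma permute_list_shift_perm:
  assumes "\<sigma> permutes {..<length t}"
  shows "permute_list (shift_perm (length s) \<sigma>) (s @ t) = s @ permute_list \<sigma> t"
proof (rule nth_equalityI)
  fix i assume i: "i < length (permute_list (shift_perm (length s) \<sigma>) (s @ t))"
  then show "permute_list (shift_perm (length s) \<sigma>) (s @ t) ! i = (s @ permute_list \<sigma> t) ! i"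
    by (auto simp: permute_list_def nth_append shift_perm_def)
qed simp

definition swap_perm :: "nat \<Rightarrow> nat \<Rightarrow> nat \<Rightarrow> nat" where
  "swap_perm n m i = (if i < m then n + i else if i < n + m then i - m else i)"

lemma swap_perm_permutes: "swap_perm n m permutes {..<n + m}"
  by (rule inj_imp_permutes) (auto simp: inj_on_def swap_perm_def split: if_splits)

lemma permute_list_swap_perm:
  "permute_list (swap_perm (length s) (length t)) (s @ t) = t @ s"
  by (rule nth_equalityI) (auto simp: permute_list_def nth_append swap_perm_def)

lemma permute_list_inv:
  assumes "\<sigma> permutes {..<length s}"
  shows "permute_list (inv \<sigma>) (permute_list \<sigma> s) = s"
  using permute_list_compose[OF permutes_inv[OF assms], of \<sigma>] permutes_inv_o(1)[OF assms] by simp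

lemma permute_list_eq_zero_string_iff:
  assumes "\<sigma> permutes {..<n}" "length s = n"
  shows "permute_list \<sigma> s = zero_string n \<longleftrightarrow> s = zero_string n"
proof -
  have zero: "permute_list \<tau> (zero_string n) = zero_string n" if "\<tau> permutes {..<n}" for \<tau>
    using permutes_in_image[OF that] by (simp add: permute_list_def zero_string_def list_eq_iff_nth_eq)
  show ?thesis
    using zero[OF assms(1)] zero[OF permutes_inv[OF assms(1)]] permute_list_inv[of \<sigma> s] assms by metis
qed

lemma permute_in_bool_funs:
  assumes "f \<in> bool_funs n" "\<sigma> permutes {..<n}"
  shows "(\<lambda>s\<in>strings n. f (permute_list \<sigma> s)) \<in> bool_funs n"
proof (rule restrict_in_bool_funs)
  show "f (permute_list \<sigma> s) = 0 \<or> f (permute_list \<sigma> s) = 1" if "s \<in> strings n" for s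
    using that by (intro bool_fun_01[OF assms(1)]) simp
  have "permute_list \<sigma> (zero_string n) = zero_string n"
    using permute_list_eq_zero_string_iff[OF assms(2), of "zero_string n"] by simp
  then show "f (permute_list \<sigma> (zero_string n)) = 1" using bool_fun_zero[OF assms(1)] by simp
qed

section \<open>Causal products with a ranked factor\<close>

text \<open>Entry \<open>i\<close> of \<open>[0..<n]\<close> is \<open>i\<close> itself, so the list
  of positions sorted by rank is the list of values of the permutation that sorts it.\<close>

lemma ex_sorting_permutation:
  fixes r :: "nat \<Rightarrow> nat"
  shows "\<exists>\<sigma>. \<sigma> permutes {..<n} \<and> (\<forall>i j. i \<le> j \<longrightarrow> j < n \<longrightarrow> r (\<sigma> i) \<le> r (\<sigma> j))"
proof -
  have "mset (sort_key r [0..<n]) = mset [0..<n]" by simp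
  then obtain \<sigma> where s: "\<sigma> permutes {..<length [0..<n]}"
    and eq: "permute_list \<sigma> [0..<n] = sort_key r [0..<n]"
    by (rule mset_eq_permutation)
  have nth: "sort_key r [0..<n] ! i = \<sigma> i" if "i < n" for i
    using that permutes_in_image[OF s, of i] by (simp flip: eq add: permute_list_def)
  have "r (\<sigma> i) \<le> r (\<sigma> j)" if "i \<le> j" "j < n" for i j
    using sorted_nth_mono[of "map r (sort_key r [0..<n])" i j] that by (simp add: nth)
  then show ?thesis using s by auto
qed

text \<open>Induction on the number of positions of \<open>f\<close>. Asking only for a ranked
  member of \<open>bool_funs n\<close> lets the peeling reach \<open>n = 0\<close>, where there is
  no type function but the product is simply \<open>g\<close>.\<close>

lemma type_fun_causal_prod_sorted_left:
  assumes "type_fun m g" "f \<in> bool_funs n" "ranked n f r"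
    and "\<And>i j. i \<le> j \<Longrightarrow> j < n \<Longrightarrow> r i \<le> r j"
  shows "type_fun (n + m) (causal_prod n m f g)"
  using assms
proof (induction n arbitrary: f g r)
  case 0
  have "causal_prod 0 m f g = g"
    using bool_fun_ext[OF type_fun_bool_funs[OF 0(1)]]
    by (intro causal_prod_eqI 0 type_fun_bool_funs) (auto simp: zero_string_def)
  with 0 show ?case by simp
next
  case (Suc n)
  \<comment> \<open>Stated for arbitrary factors so that it applies both to the given pair and to
    its dual.\<close>
  have even_case: "type_fun (Suc n + m) (causal_prod (Suc n) m h k)"
    if k: "type_fun m k" and h: "h \<in> bool_funs (Suc n)" and q: "ranked (Suc n) h q"
      and mono: "\<And>i j. i \<le> j \<Longrightarrow> j < Suc n \<Longrightarrow> q i \<le> q j" and ev: "even (q 0)" for h k q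
  proof -
    define h' where "h' = (\<lambda>s\<in>strings n. h (False # s))"
    have h': "h' \<in> bool_funs n" unfolding h'_def
    proof (rule restrict_in_bool_funs)
      show "h (False # s) = 0 \<or> h (False # s) = 1" if "s \<in> strings n" for s
        using that by (intro bool_fun_01[OF h]) simp
      show "h (False # zero_string n) = 1"
        using bool_fun_zero[OF h] by (simp add: zero_string_def)
    qed
    have "ranked n h' (\<lambda>i. q (Suc i))" unfolding ranked_def
    proof (intro allI impI)
      fix s :: "bool list" and j
      assume s: "length s = n" "j < n" "s ! j" "\<forall>k<n. s ! k \<longrightarrow> q (Suc j) \<le> q (Suc k)"
      then have "h (False # s) = of_bool (odd (q (Suc j)))"
        by (intro rankedD[OF q]) (auto simp: nth_Cons split: nat.splits)
      then show "h' s = of_bool (odd (q (Suc j)))" using s by (simp add: h'_def)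
    qed
    then have "type_fun (n + m) (causal_prod n m h' k)"
      by (rule Suc.IH[OF k h']) (use mono in simp)
    \<comment> \<open>\<open>dual_fun 1 (one_fun 1)\<close> is the point function on one bit, the
      factor split off at position 0.\<close>
    from type_fun.tensor[OF type_fun.dual[OF type_fun.one] this]
    have "type_fun (Suc n + m) (tensor_fun 1 (n + m) (dual_fun 1 (one_fun 1)) (causal_prod n m h' k))"
      by simp
    moreover have "causal_prod (Suc n) m h k
        = tensor_fun 1 (n + m) (dual_fun 1 (one_fun 1)) (causal_prod n m h' k)"
    proof (rule causal_prod_eqI[OF h type_fun_bool_funs[OF k]])
      fix s t :: "bool list" assume s: "length s = Suc n" and t: "length t = m"
      then obtain x s' where xs: "s = x # s'" and s': "length s' = n" by (cases s) auto
      \<comment> \<open>Position 0 has the lowest rank, and that rank is even.\<close>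
      have "h (True # s') = 0"
        using rankedD[OF q, of "True # s'" 0] mono s' ev by simp
      moreover have "dual_fun 1 (one_fun 1) [x] = of_bool (\<not> x)"
        by (cases x) (simp_all add: dual_fun_apply one_fun_def zero_string_def)
      moreover have "tensor_fun 1 (n + m) (dual_fun 1 (one_fun 1)) (causal_prod n m h' k) ([x] @ (s' @ t))
          = dual_fun 1 (one_fun 1) [x] * causal_prod n m h' k (s' @ t)"
        by (rule tensor_fun_append) (use s' t in simp_all)
      moreover have "causal_prod n m h' k (s' @ t) = (if s' = zero_string n then k t else h (False # s'))"
        using causal_prod_append[OF h', of s' t m k] s' t by (simp add: h'_def)
      ultimately show "tensor_fun 1 (n + m) (dual_fun 1 (one_fun 1)) (causal_prod n m h' k) (s @ t)
          = (if s = zero_string (Suc n) then k t else h s)"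
        using xs by (cases x) (auto simp: zero_string_def)
    qed (simp add: tensor_fun_def)
    ultimately show ?thesis by simp
  qed
  show ?case
  proof (cases "even (r 0)")
    case True
    then show ?thesis using even_case Suc.prems by blast
  next
    case False
    have fg: "f \<in> bool_funs (Suc n)" "g \<in> bool_funs m"
      using Suc.prems type_fun_bool_funs by auto
    \<comment> \<open>Dualising makes the lowest rank even; a second dualisation returns to the
      original product.\<close>
    have "type_fun (Suc n + m) (causal_prod (Suc n) m (dual_fun (Suc n) f) (dual_fun m g))"
      by (rule even_case[where q = "\<lambda>i. Suc (r i)"])
        (use False Suc.prems in \<open>auto simp: type_fun.dual dual_fun_in_bool_funs ranked_dual\<close>)
    from type_fun.dual[OF this] show ?thesis
      by (simp only: dual_causal_prod[OF fg, symmetric]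
          dual_dual_fun[OF causal_prod_in_bool_funs[OF fg]])
  qed
qed

text \<open>A last position of highest, odd rank is neutral: alone it gives 1, like the zero string,
  and next to another 1 it does not affect the value. It therefore splits off as a factor
  \<open>one_fun 1\<close>; an even highest rank is handled by duality.\<close>

lemma type_fun_causal_prod_sorted_right:
  assumes "type_fun n f" "g \<in> bool_funs m" "ranked m g r"
    and "\<And>i j. i \<le> j \<Longrightarrow> j < m \<Longrightarrow> r i \<le> r j"
  shows "type_fun (n + m) (causal_prod n m f g)"
  using assms
proof (induction m arbitrary: f g r)
  case 0
  have f: "f \<in> bool_funs n" using 0 type_fun_bool_funs by blast
  have "causal_prod n 0 f g = f"
    using bool_fun_ext[OF f] bool_fun_zero[OF 0(2)] bool_fun_zero[OF f]
    by (intro causal_prod_eqI 0 f) (auto simp: zero_string_def)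
  with 0 show ?case by simp
next
  case (Suc m)
  have odd_case: "type_fun (n + Suc m) (causal_prod n (Suc m) h k)"
    if h: "type_fun n h" and k: "k \<in> bool_funs (Suc m)" and q: "ranked (Suc m) k q"
      and mono: "\<And>i j. i \<le> j \<Longrightarrow> j < Suc m \<Longrightarrow> q i \<le> q j" and od: "odd (q m)" for h k q
  proof -
    define k' where "k' = (\<lambda>s\<in>strings m. k (s @ [False]))"
    have hb: "h \<in> bool_funs n" using h by (rule type_fun_bool_funs)
    have zs: "zero_string (Suc m) = zero_string m @ [False]"
      by (simp add: zero_string_def replicate_append_same)
    have k': "k' \<in> bool_funs m" unfolding k'_def
    proof (rule restrict_in_bool_funs)
      show "k (s @ [False]) = 0 \<or> k (s @ [False]) = 1" if "s \<in> strings m" for s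
        using that by (intro bool_fun_01[OF k]) simp
      show "k (zero_string m @ [False]) = 1" using bool_fun_zero[OF k] by (simp add: zs)
    qed
    \<comment> \<open>No rank exceeds that of position \<open>m\<close>, so \<open>j\<close> stays
      minimal whatever bit is appended.\<close>
    have val: "k (s @ [x]) = of_bool (odd (q j))"
      if "length s = m" "j < m" "s ! j" "\<And>i. i < m \<Longrightarrow> s ! i \<Longrightarrow> q j \<le> q i" for s x j
      by (rule rankedD[OF q]) (use that mono in \<open>auto simp: nth_append less_Suc_eq\<close>)
    then have "ranked m k' q" unfolding ranked_def k'_def by auto
    then have "type_fun (n + m) (causal_prod n m h k')"
      by (rule Suc.IH[OF h k']) (use mono in simp)
    from type_fun.tensor[OF this type_fun.one]
    have "type_fun (n + Suc m) (tensor_fun (n + m) 1 (causal_prod n m h k') (one_fun 1))"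
      by simp
    moreover have "causal_prod n (Suc m) h k = tensor_fun (n + m) 1 (causal_prod n m h k') (one_fun 1)"
    proof (rule causal_prod_eqI[OF hb k])
      fix s t :: "bool list" assume s: "length s = n" and t: "length t = Suc m"
      then obtain t' x where tx: "t = t' @ [x]" and t': "length t' = m"
        by (cases t rule: rev_cases) auto
      have last: "k (t' @ [x]) = k (t' @ [False])"
      proof (cases "t' = zero_string m")
        case True
        have "k (zero_string m @ [True]) = of_bool (odd (q m))"
          by (rule rankedD[OF q])
            (auto simp: nth_append zero_string_def less_Suc_eq split: if_splits)
        then show ?thesis using True od bool_fun_zero[OF k] by (cases x) (auto simp: zs)
      next
        case False
        then obtain j where "j < m" "t' ! j" "\<And>i. i < m \<Longrightarrow> t' ! i \<Longrightarrow> q j \<le> q i"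
          using obtain_min_rank t' by metis
        then show ?thesis using val t' by metis
      qed
      have "tensor_fun (n + m) 1 (causal_prod n m h k') (one_fun 1) ((s @ t') @ [x])
          = causal_prod n m h k' (s @ t') * one_fun 1 [x]"
        by (rule tensor_fun_append) (use s t' in simp_all)
      moreover have "causal_prod n m h k' (s @ t') = (if s = zero_string n then k (t' @ [False]) else h s)"
        using causal_prod_append[OF hb, of s t' m k'] s t' by (simp add: k'_def)
      ultimately show "tensor_fun (n + m) 1 (causal_prod n m h k') (one_fun 1) (s @ t)
          = (if s = zero_string n then k t else h s)"
        using tx last by (simp add: one_fun_def)
    qed (simp add: tensor_fun_def)
    ultimately show ?thesis by simp
  qed
  show ?case
  proof (cases "odd (r m)")
    case True
    then show ?thesis using odd_case Suc.prems by blast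
  next
    case False
    have fg: "f \<in> bool_funs n" "g \<in> bool_funs (Suc m)"
      using Suc.prems type_fun_bool_funs by auto
    have "type_fun (n + Suc m) (causal_prod n (Suc m) (dual_fun n f) (dual_fun (Suc m) g))"
      by (rule odd_case[where q = "\<lambda>i. Suc (r i)"])
        (use False Suc.prems in \<open>auto simp: type_fun.dual dual_fun_in_bool_funs ranked_dual\<close>)
    from type_fun.dual[OF this] show ?thesis
      by (simp only: dual_causal_prod[OF fg, symmetric]
          dual_dual_fun[OF causal_prod_in_bool_funs[OF fg]])
  qed
qed

text \<open>Sorting the positions of \<open>f\<close> by rank gives the sorted case. The permutation
  fixes all positions from \<open>n\<close> on, so the same permutation undoes the sorting inside
  the product.\<close>

lemma type_fun_causal_prod_left:
  assumes g: "type_fun m g" and f: "f \<in> bool_funs n" and r: "ranked n f r"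
  shows "type_fun (n + m) (causal_prod n m f g)"
proof -
  obtain \<sigma> where p: "\<sigma> permutes {..<n}" and mono: "\<And>i j. i \<le> j \<Longrightarrow> j < n \<Longrightarrow> r (\<sigma> i) \<le> r (\<sigma> j)"
    using ex_sorting_permutation by metis
  define f' where "f' = (\<lambda>s\<in>strings n. f (permute_list (inv \<sigma>) s))"
  have f': "f' \<in> bool_funs n"
    unfolding f'_def by (rule permute_in_bool_funs[OF f permutes_inv[OF p]])
  have "ranked n f' (\<lambda>i. r (\<sigma> i))"
    using ranked_permute[OF r permutes_inv[OF p]] by (simp add: f'_def permutes_inv_inv[OF p])
  then have "type_fun (n + m) (causal_prod n m f' g)"
    by (rule type_fun_causal_prod_sorted_left[OF g f']) (rule mono)
  then have "type_fun (n + m) (\<lambda>s\<in>strings (n + m). causal_prod n m f' g (permute_list \<sigma> s))"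
    by (rule type_fun_permute) (rule permutes_subset[OF p], auto)
  moreover have "causal_prod n m f g = (\<lambda>s\<in>strings (n + m). causal_prod n m f' g (permute_list \<sigma> s))"
  proof (rule causal_prod_eqI[OF f type_fun_bool_funs[OF g]])
    fix s t :: "bool list" assume s: "length s = n" and t: "length t = m"
    then show "(\<lambda>s\<in>strings (n + m). causal_prod n m f' g (permute_list \<sigma> s)) (s @ t)
        = (if s = zero_string n then g t else f s)"
      using causal_prod_append[OF f', of "permute_list \<sigma> s" t m g] p permute_list_inv[of \<sigma> s]
      by (simp add: permute_list_append_left permute_list_eq_zero_string_iff f'_def)
  qed simp
  ultimately show ?thesis by simp
qed

text \<open>As on the left, except that undoing the sorting inside the product requires the
  permutation shifted past the first \<open>n\<close> positions.\<close>

lemma type_fun_causal_prod_right: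
  assumes f: "type_fun n f" and g: "g \<in> bool_funs m" and r: "ranked m g r"
  shows "type_fun (n + m) (causal_prod n m f g)"
proof -
  obtain \<sigma> where p: "\<sigma> permutes {..<m}" and mono: "\<And>i j. i \<le> j \<Longrightarrow> j < m \<Longrightarrow> r (\<sigma> i) \<le> r (\<sigma> j)"
    using ex_sorting_permutation by metis
  define g' where "g' = (\<lambda>s\<in>strings m. g (permute_list (inv \<sigma>) s))"
  have g': "g' \<in> bool_funs m"
    unfolding g'_def by (rule permute_in_bool_funs[OF g permutes_inv[OF p]])
  have "ranked m g' (\<lambda>i. r (\<sigma> i))"
    using ranked_permute[OF r permutes_inv[OF p]] by (simp add: g'_def permutes_inv_inv[OF p])
  then have "type_fun (n + m) (causal_prod n m f g')"
    by (rule type_fun_causal_prod_sorted_right[OF f g']) (rule mono)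
  then have "type_fun (n + m)
      (\<lambda>s\<in>strings (n + m). causal_prod n m f g' (permute_list (shift_perm n \<sigma>) s))"
    by (rule type_fun_permute[OF _ shift_perm_permutes[OF p]])
  moreover have "causal_prod n m f g
      = (\<lambda>s\<in>strings (n + m). causal_prod n m f g' (permute_list (shift_perm n \<sigma>) s))"
  proof (rule causal_prod_eqI[OF type_fun_bool_funs[OF f] g])
    fix s t :: "bool list" assume s: "length s = n" and t: "length t = m"
    then show "(\<lambda>s\<in>strings (n + m). causal_prod n m f g' (permute_list (shift_perm n \<sigma>) s)) (s @ t)
        = (if s = zero_string n then g t else f s)"
      using causal_prod_append[OF type_fun_bool_funs[OF f], of s "permute_list \<sigma> t" m g'] p
        permute_list_inv[of \<sigma> t] permute_list_shift_perm[of \<sigma> t s]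
      by (simp add: g'_def)
  qed simp
  ultimately show ?thesis by simp
qed

section \<open>Ranked tensor products\<close>

lemma ranked_tensor_left:
  assumes f: "f \<in> bool_funs n" "ranked n f r" and g: "g \<in> bool_funs m" "ranked m g q"
    and dom: "\<And>a b. a < n \<Longrightarrow> b < n \<Longrightarrow> odd (r a) \<Longrightarrow> even (r b) \<Longrightarrow> r b < r a"
  shows "\<exists>r'. ranked (n + m) (tensor_fun n m f g) r'"
proof -
  obtain K where K: "\<And>i. i < m \<Longrightarrow> q i < K"
    using finite_nat_set_iff_bounded[of "q ` {..<m}"] by auto
  txt \<open>By \<open>dom\<close> the function \<open>f\<close> is \<open>p\<^sub>T\<close> for the set \<open>T\<close> of its even positions: these get the
    bottom rank, while its odd positions are neutral in the product and get the top rank.\<close>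
  define r' where "r' i = (if i < n then if odd (r i) then 2 * K + 3 else 0 else q (i - n) + 2)" for i
  have "ranked (n + m) (tensor_fun n m f g) r'"
    unfolding ranked_def
  proof (intro allI impI)
    fix s :: "bool list" and j
    assume s: "length s = n + m" and j: "j < n + m" "s ! j"
      and min: "\<forall>k<n + m. s ! k \<longrightarrow> r' j \<le> r' k"
    have val: "tensor_fun n m f g s = f (take n s) * g (drop n s)"
      using s by (simp add: tensor_fun_def)
    have right: "g (drop n s) = of_bool (odd (r' j))" if "n \<le> j"
    proof -
      have "g (drop n s) = of_bool (odd (q (j - n)))"
      proof (rule rankedD[OF g(2)])
        show "q (j - n) \<le> q k" if "k < m" "drop n s ! k" for k
          using min[rule_format, of "n + k"] that s \<open>n \<le> j\<close> by (simp add: r'_def)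
      qed (use s j \<open>n \<le> j\<close> in auto)
      then show ?thesis using that by (simp add: r'_def)
    qed
    show "tensor_fun n m f g s = of_bool (odd (r' j))"
    \<comment> \<open>By \<open>dom\<close> even ranks lie below odd ones, so a 1 at an even
      position makes the minimum of the prefix even and \<open>f\<close> zero there. Otherwise
      \<open>f\<close> is 1 there and the product reduces to \<open>g\<close>.\<close>
    proof (cases "\<exists>b<n. s ! b \<and> even (r b)")
      case True
      then obtain b where b: "b < n" "s ! b" "even (r b)" by blast
      then have "r' j = 0" using min[rule_format, of b] by (simp add: r'_def)
      have "take n s \<noteq> zero_string n" using b s eq_zero_string_iff[of "take n s" n] by auto
      then obtain i where i: "i < n" "take n s ! i" "\<And>k. k < n \<Longrightarrow> take n s ! k \<Longrightarrow> r i \<le> r k"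
        using obtain_min_rank[of "take n s" n r] s by auto
      have "r i \<le> r b" using i(3)[of b] b by simp
      then have "even (r i)" using dom[of i b] i(1) b by fastforce
      then have "f (take n s) = 0" using rankedD[OF f(2) _ i] s by simp
      then show ?thesis using val \<open>r' j = 0\<close> by simp
    next
      case False
      have left: "f (take n s) = 1"
      proof (cases "take n s = zero_string n")
        case True
        then show ?thesis using bool_fun_zero[OF f(1)] by simp
      next
        case False
        then obtain i where i: "i < n" "take n s ! i" "\<And>k. k < n \<Longrightarrow> take n s ! k \<Longrightarrow> r i \<le> r k"
          using obtain_min_rank[of "take n s" n r] s by auto
        then have "odd (r i)" using \<open>\<not> (\<exists>b<n. s ! b \<and> even (r b))\<close> by auto
        then show ?thesis using rankedD[OF f(2) _ i] s by simp
      qed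
      show ?thesis
      proof (cases "n \<le> j")
        case True
        then show ?thesis using val left right by simp
      next
        case jn: False
        then have "r' j = 2 * K + 3" using False j by (simp add: r'_def)
        \<comment> \<open>All ranks on the right are below \<open>2 * K + 3\<close>, so a minimum of
          that size leaves the right block zero.\<close>
        have "\<not> s ! (n + k)" if "k < m" for k
          using min[rule_format, of "n + k"] that K[of k] \<open>r' j = 2 * K + 3\<close> by (auto simp: r'_def)
        then have "drop n s = zero_string m" using s by (simp add: eq_zero_string_iff)
        then show ?thesis using val left bool_fun_zero[OF g(1)] \<open>r' j = 2 * K + 3\<close> by simp
      qed
    qed
  qed
  then show ?thesis by blast
qed

lemma tensor_fun_commute:
  "tensor_fun n m f g = (\<lambda>s\<in>strings (n + m). tensor_fun m n g f (permute_list (swap_perm n m) s))"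
proof
  fix s :: "bool list"
  show "tensor_fun n m f g s
      = (\<lambda>s\<in>strings (n + m). tensor_fun m n g f (permute_list (swap_perm n m) s)) s"
  proof (cases "length s = n + m")
    case True
    then have "permute_list (swap_perm n m) s = drop n s @ take n s"
      using permute_list_swap_perm[of "take n s" "drop n s"] by simp
    then show ?thesis using True by (simp add: tensor_fun_def add.commute mult.commute)
  qed (simp add: tensor_fun_def)
qed

lemma ranked_tensor_right:
  assumes "f \<in> bool_funs n" "ranked n f r" "g \<in> bool_funs m" "ranked m g q"
    and "\<And>a b. a < m \<Longrightarrow> b < m \<Longrightarrow> odd (q a) \<Longrightarrow> even (q b) \<Longrightarrow> q b < q a"
  shows "\<exists>r'. ranked (n + m) (tensor_fun n m f g) r'"
proof -
  obtain r' where "ranked (m + n) (tensor_fun m n g f) r'"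
    using ranked_tensor_left[OF assms(3,4,1,2,5)] by blast
  then have "ranked (n + m) (tensor_fun m n g f) r'" by (simp add: add.commute)
  from ranked_permute[OF this swap_perm_permutes] show ?thesis
    by (subst tensor_fun_commute) blast
qed

section \<open>The beating relation and its cycles\<close>

definition bits :: "nat \<Rightarrow> nat set \<Rightarrow> bool list" where
  "bits n X = map (\<lambda>i. i \<in> X) [0..<n]"

lemma length_bits [simp]: "length (bits n X) = n"
  by (simp add: bits_def)

lemma nth_bits [simp]: "i < n \<Longrightarrow> bits n X ! i \<longleftrightarrow> i \<in> X"
  by (simp add: bits_def)

lemma bits_eq_zero_string_iff: "bits n X = zero_string n \<longleftrightarrow> X \<inter> {..<n} = {}"
  by (auto simp: eq_zero_string_iff)

lemma bits_union:
  assumes "X \<subseteq> {..<n}"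
  shows "bits (n + m) (X \<union> (+) n ` Y) = bits n X @ bits m Y"
proof (rule nth_equalityI)
  fix i assume "i < length (bits (n + m) (X \<union> (+) n ` Y))"
  then show "bits (n + m) (X \<union> (+) n ` Y) ! i = (bits n X @ bits m Y) ! i"
    using assms image_eqI[of i "(+) n" "i - n" Y] by (cases "i < n") (auto simp: nth_append)
qed simp

lemma permute_list_bits:
  assumes "\<sigma> permutes {..<n}"
  shows "permute_list (inv \<sigma>) (bits n X) = bits n (\<sigma> ` X)"
proof (rule nth_equalityI)
  fix i assume "i < length (permute_list (inv \<sigma>) (bits n X))"
  then have "i < n" by simp
  then have "inv \<sigma> i < n" using permutes_in_image[OF permutes_inv[OF assms], of i] by simp
  moreover have "inv \<sigma> i \<in> X \<longleftrightarrow> i \<in> \<sigma> ` X"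
    using permutes_inverses[OF assms] by (metis image_iff)
  ultimately show "permute_list (inv \<sigma>) (bits n X) ! i = bits n (\<sigma> ` X) ! i"
    using \<open>i < n\<close> by (simp add: permute_list_def)
qed simp

lemma tensor_fun_bits:
  assumes "f \<in> bool_funs n" "g \<in> bool_funs m" "X \<subseteq> {..<n}"
  shows "tensor_fun n m f g (bits (n + m) (X \<union> (+) n ` Y)) = f (bits n X) * g (bits m Y)"
  using assms by (simp add: bits_union tensor_fun_append)

lemma bool_fun_bits_empty: "f \<in> bool_funs n \<Longrightarrow> f (bits n {}) = 1"
  using bool_fun_zero[of f n] bits_eq_zero_string_iff[of n "{}"] by simp

lemma tensor_fun_bits_left:
  assumes "f \<in> bool_funs n" "g \<in> bool_funs m" "X \<subseteq> {..<n}"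
  shows "tensor_fun n m f g (bits (n + m) X) = f (bits n X)"
  using tensor_fun_bits[OF assms, of "{}"] bool_fun_bits_empty[OF assms(2)] by simp

lemma tensor_fun_bits_right:
  assumes "f \<in> bool_funs n" "g \<in> bool_funs m"
  shows "tensor_fun n m f g (bits (n + m) ((+) n ` Y)) = g (bits m Y)"
  using tensor_fun_bits[OF assms, of "{}" Y] bool_fun_bits_empty[OF assms(1)] by simp

lemma causal_prod_bits_left:
  assumes "f \<in> bool_funs n" "X \<subseteq> {..<n}" "X \<noteq> {}"
  shows "causal_prod n m f g (bits (n + m) (X \<union> (+) n ` Y)) = f (bits n X)"
proof -
  have "bits n X \<noteq> zero_string n" using assms by (auto simp: bits_eq_zero_string_iff)
  then show ?thesis
    using causal_prod_append[OF assms(1), of "bits n X" "bits m Y" m g] assms(2)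
    by (simp add: bits_union)
qed

lemma causal_prod_bits_right:
  assumes "f \<in> bool_funs n"
  shows "causal_prod n m f g (bits (n + m) ((+) n ` Y)) = g (bits m Y)"
  using causal_prod_append[OF assms, of "bits n {}" "bits m Y" m g] bits_union[of "{}" n m Y]
    bits_eq_zero_string_iff[of n "{}"] by simp

text \<open>In a ranked function a position can only beat one of strictly larger rank, so a cycle of
  this relation rules out any rank.\<close>

definition beats :: "nat \<Rightarrow> (bool list \<Rightarrow> int) \<Rightarrow> nat \<Rightarrow> nat \<Rightarrow> bool" where
  "beats n f a b \<longleftrightarrow> a < n \<and> b < n \<and> f (bits n {a}) \<noteq> f (bits n {b}) \<and>
     f (bits n {a, b}) = f (bits n {a})"

text \<open>Values alternate along a cycle and two positions never beat each other, so four is the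
  least possible length and the four positions are distinct.\<close>

definition beat_cycle :: "nat \<Rightarrow> (bool list \<Rightarrow> int) \<Rightarrow> nat set \<Rightarrow> bool" where
  "beat_cycle n f A \<longleftrightarrow> (\<exists>a b c d. A = {a, b, c, d} \<and>
     beats n f a b \<and> beats n f b c \<and> beats n f c d \<and> beats n f d a)"

lemma beat_cycle_image:
  assumes "beat_cycle n f A"
    and "\<And>x y. x \<in> A \<Longrightarrow> y \<in> A \<Longrightarrow> beats n f x y \<Longrightarrow> beats k h (\<phi> x) (\<phi> y)"
  shows "beat_cycle k h (\<phi> ` A)"
proof -
  obtain a b c d where A: "A = {a, b, c, d}"
    and ab: "beats n f a b" "beats n f b c" "beats n f c d" "beats n f d a"
    using assms(1) unfolding beat_cycle_def by blast
  have "\<phi> ` A = {\<phi> a, \<phi> b, \<phi> c, \<phi> d}" using A by simp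
  moreover have "beats k h (\<phi> a) (\<phi> b)" "beats k h (\<phi> b) (\<phi> c)"
    "beats k h (\<phi> c) (\<phi> d)" "beats k h (\<phi> d) (\<phi> a)"
    using ab by (simp_all add: assms(2) A)
  ultimately show ?thesis unfolding beat_cycle_def by blast
qed

lemma beat_cycle_subset: "beat_cycle n f A \<Longrightarrow> A \<subseteq> {..<n}"
  unfolding beat_cycle_def beats_def by auto

section \<open>Beating under duality, permutations and products\<close>

lemma dual_fun_bits: "X \<inter> {..<n} \<noteq> {} \<Longrightarrow> dual_fun n f (bits n X) = 1 - f (bits n X)"
  by (simp add: dual_fun_apply bits_eq_zero_string_iff)

lemma beats_dual: "beats n (dual_fun n f) a b \<longleftrightarrow> beats n f a b"
  unfolding beats_def by (auto simp: dual_fun_bits)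

lemma perm_fun_bits:
  "\<sigma> permutes {..<n} \<Longrightarrow> perm_fun n \<sigma> f (bits n X) = f (bits n (\<sigma> ` X))"
  by (simp add: perm_fun_def permute_list_bits)

lemma beats_perm:
  assumes "\<sigma> permutes {..<n}"
  shows "beats n (perm_fun n \<sigma> f) a b \<longleftrightarrow> beats n f (\<sigma> a) (\<sigma> b)"
  unfolding beats_def using permutes_in_image[OF assms] by (auto simp: perm_fun_bits[OF assms])

lemma beats_tensor_left:
  assumes "f \<in> bool_funs n" "g \<in> bool_funs m" "a < n" "b < n"
  shows "beats (n + m) (tensor_fun n m f g) a b \<longleftrightarrow> beats n f a b"
  unfolding beats_def using assms by (auto simp: tensor_fun_bits_left)

lemma beats_tensor_right:
  assumes "f \<in> bool_funs n" "g \<in> bool_funs m"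
  shows "beats (n + m) (tensor_fun n m f g) (n + a) (n + b) \<longleftrightarrow> beats m g a b"
  unfolding beats_def
  using tensor_fun_bits_right[OF assms, of "{a}"] tensor_fun_bits_right[OF assms, of "{b}"]
    tensor_fun_bits_right[OF assms, of "{a, b}"] by auto

lemma beats_causal_left:
  assumes "f \<in> bool_funs n" "a < n" "b < n"
  shows "beats (n + m) (causal_prod n m f g) a b \<longleftrightarrow> beats n f a b"
  unfolding beats_def
  using causal_prod_bits_left[OF assms(1), of "{a}" m g "{}"]
    causal_prod_bits_left[OF assms(1), of "{b}" m g "{}"]
    causal_prod_bits_left[OF assms(1), of "{a, b}" m g "{}"] assms by auto

lemma beats_causal_right:
  assumes "f \<in> bool_funs n"
  shows "beats (n + m) (causal_prod n m f g) (n + a) (n + b) \<longleftrightarrow> beats m g a b"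
  unfolding beats_def
  using causal_prod_bits_right[OF assms, of m g "{a}"] causal_prod_bits_right[OF assms, of m g "{b}"]
    causal_prod_bits_right[OF assms, of m g "{a, b}"] by auto

section \<open>The dichotomy between ranks and cycles\<close>

lemma beats_ranked:
  assumes r: "ranked n f r" and "a < n" "b < n" "odd (r a) \<noteq> odd (r b)" "r a \<le> r b"
  shows "beats n f a b" "f (bits n {a}) = of_bool (odd (r a))"
proof -
  have "f (bits n {a}) = of_bool (odd (r a))" "f (bits n {b}) = of_bool (odd (r b))"
    using rankedD[OF r, of "bits n {a}" a] rankedD[OF r, of "bits n {b}" b] assms by simp_all
  moreover have "f (bits n {a, b}) = of_bool (odd (r a))"
    by (rule rankedD[OF r]) (use assms in auto)
  moreover note assms
  ultimately show "beats n f a b" "f (bits n {a}) = of_bool (odd (r a))"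
    unfolding beats_def by auto
qed

text \<open>The value on a pair from different factors is the product of the two values. If these
  differ, the product is 0, so the position of value 0 wins.\<close>

lemma beats_tensor_cross:
  assumes f: "f \<in> bool_funs n" and g: "g \<in> bool_funs m" and "a < n" "b < m"
    and "f (bits n {a}) \<noteq> g (bits m {b})"
  shows "beats (n + m) (tensor_fun n m f g) a (n + b) \<longleftrightarrow> f (bits n {a}) = 0"
    "beats (n + m) (tensor_fun n m f g) (n + b) a \<longleftrightarrow> g (bits m {b}) = 0"
proof -
  have eq: "{a, n + b} = {a} \<union> (+) n ` {b}" "{n + b, a} = {a} \<union> (+) n ` {b}" by auto
  have "tensor_fun n m f g (bits (n + m) {a, n + b}) = f (bits n {a}) * g (bits m {b})"
    "tensor_fun n m f g (bits (n + m) {n + b, a}) = f (bits n {a}) * g (bits m {b})"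
    unfolding eq by (rule tensor_fun_bits[OF f g], use assms in simp)+
  moreover have "tensor_fun n m f g (bits (n + m) {a}) = f (bits n {a})"
    "tensor_fun n m f g (bits (n + m) {n + b}) = g (bits m {b})"
    using tensor_fun_bits_left[OF f g, of "{a}"] tensor_fun_bits_right[OF f g, of "{b}"] assms
    by simp_all
  moreover have "f (bits n {a}) = 0 \<or> f (bits n {a}) = 1" "g (bits m {b}) = 0 \<or> g (bits m {b}) = 1"
    by (simp_all add: bool_fun_01[OF f] bool_fun_01[OF g])
  ultimately show "beats (n + m) (tensor_fun n m f g) a (n + b) \<longleftrightarrow> f (bits n {a}) = 0"
    "beats (n + m) (tensor_fun n m f g) (n + b) a \<longleftrightarrow> g (bits m {b}) = 0"
    unfolding beats_def using assms by auto
qed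

text \<open>Cycles survive every rule, and ranks survive duality and permutation. Only a tensor
  product of two ranked functions can create a new cycle.\<close>

lemma ranked_or_beat_cycle:
  "type_fun n f \<Longrightarrow> (\<exists>r. ranked n f r) \<or> (\<exists>A. beat_cycle n f A)"
proof (induction rule: type_fun.induct)
  case one
  then show ?case using ranked_one by blast
next
  case (dual n f)
  have "beat_cycle n (dual_fun n f) A \<longleftrightarrow> beat_cycle n f A" for A
    by (simp add: beat_cycle_def beats_dual)
  with dual.IH show ?case using ranked_dual by blast
next
  case (perm n f \<sigma>)
  from perm.IH show ?case
  proof
    assume "\<exists>r. ranked n f r"
    then show ?thesis
      unfolding perm_fun_def using ranked_permute permutes_inv[OF perm(2)] by blast
  next
    assume "\<exists>A. beat_cycle n f A"
    then obtain A where "beat_cycle n f A" ..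
    then have "beat_cycle n (perm_fun n \<sigma> f) (inv \<sigma> ` A)"
      by (rule beat_cycle_image) (simp add: beats_perm perm(2) permutes_inverses[OF perm(2)])
    then show ?thesis by blast
  qed
next
  case (tensor n f m g)
  have f: "f \<in> bool_funs n" and g: "g \<in> bool_funs m"
    using tensor type_fun_bool_funs by auto
  consider A where "beat_cycle n f A" | B where "beat_cycle m g B"
    | r q where "ranked n f r" "ranked m g q"
    using tensor.IH by blast
  then show ?case
  proof cases
    case 1
    have "beat_cycle (n + m) (tensor_fun n m f g) (id ` A)"
      by (rule beat_cycle_image[OF 1])
        (use beat_cycle_subset[OF 1] in \<open>auto simp: subset_iff beats_tensor_left[OF f g]\<close>)
    then show ?thesis by blast
  next
    case 2
    have "beat_cycle (n + m) (tensor_fun n m f g) ((+) n ` B)"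
      by (rule beat_cycle_image[OF 2]) (simp add: beats_tensor_right[OF f g])
    then show ?thesis by blast
  next
    case (3 r q)
    show ?thesis
    \<comment> \<open>If one factor has all even ranks below all odd ones, the product is ranked.
      Otherwise each factor has an odd rank at or below an even one.\<close>
    proof (cases "(\<forall>a<n. \<forall>b<n. odd (r a) \<longrightarrow> even (r b) \<longrightarrow> r b < r a) \<or>
        (\<forall>a<m. \<forall>b<m. odd (q a) \<longrightarrow> even (q b) \<longrightarrow> q b < q a)")
      case True
      then show ?thesis
        using ranked_tensor_left[OF f 3(1) g 3(2)] ranked_tensor_right[OF f 3(1) g 3(2)] by blast
    next
      case False
      then obtain a b c d where
        ab: "a < n" "b < n" "odd (r a)" "even (r b)" "r a \<le> r b" and
        cd: "c < m" "d < m" "odd (q c)" "even (q d)" "q c \<le> q d"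
        by (metis not_le)
      have fab: "beats n f a b" "f (bits n {a}) = 1"
        using beats_ranked[OF 3(1), of a b] ab by auto
      have gcd: "beats m g c d" "g (bits m {c}) = 1"
        using beats_ranked[OF 3(2), of c d] cd by auto
      have zero: "f (bits n {b}) = 0" "g (bits m {d}) = 0"
        using fab gcd bool_fun_01[OF f, of "bits n {b}"] bool_fun_01[OF g, of "bits m {d}"]
        unfolding beats_def by auto
      \<comment> \<open>The values along \<open>a\<close>, \<open>b\<close>, \<open>n + c\<close>,
        \<open>n + d\<close> are 1, 0, 1, 0. Inside a factor the smaller rank wins; across the
        factors 0 beats 1, which links the two pairs and closes the cycle.\<close>
      have "beats (n + m) (tensor_fun n m f g) a b"
        "beats (n + m) (tensor_fun n m f g) b (n + c)"
        "beats (n + m) (tensor_fun n m f g) (n + c) (n + d)"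
        "beats (n + m) (tensor_fun n m f g) (n + d) a"
        using ab cd fab gcd zero
        by (simp_all add: beats_tensor_left[OF f g] beats_tensor_right[OF f g] beats_tensor_cross[OF f g])
      then show ?thesis unfolding beat_cycle_def by blast
    qed
  qed
qed

section \<open>Stacked cycles\<close>

definition stacked_cycles :: "nat \<Rightarrow> (bool list \<Rightarrow> int) \<Rightarrow> nat set \<Rightarrow> nat set \<Rightarrow> bool" where
  "stacked_cycles n f A B \<longleftrightarrow> beat_cycle n f A \<and> beat_cycle n f B \<and>
     (\<forall>x\<in>A. \<forall>y\<in>B. f (bits n {x}) \<noteq> f (bits n {y}) \<longrightarrow> beats n f x y)"

text \<open>The hypothesis \<open>val\<close> runs backwards because an unequal pair in the image
  must be traced to an unequal pair in \<open>A\<close> and \<open>B\<close>.\<close>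

lemma stacked_cycles_image:
  assumes "stacked_cycles n f A B"
    and beats: "\<And>x y. x \<in> A \<union> B \<Longrightarrow> y \<in> A \<union> B \<Longrightarrow> beats k h (\<phi> x) (\<phi> y) \<longleftrightarrow> beats n f x y"
    and val: "\<And>x y. x \<in> A \<Longrightarrow> y \<in> B \<Longrightarrow> h (bits k {\<phi> x}) \<noteq> h (bits k {\<phi> y}) \<Longrightarrow> f (bits n {x}) \<noteq> f (bits n {y})"
  shows "stacked_cycles k h (\<phi> ` A) (\<phi> ` B)"
proof -
  have "beat_cycle n f A" "beat_cycle n f B" using assms(1) by (simp_all add: stacked_cycles_def)
  then have "beat_cycle k h (\<phi> ` A)" "beat_cycle k h (\<phi> ` B)"
    by (auto intro: beat_cycle_image simp: beats)
  moreover have "beats k h (\<phi> x) (\<phi> y)"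
    if "x \<in> A" "y \<in> B" "h (bits k {\<phi> x}) \<noteq> h (bits k {\<phi> y})" for x y
    using assms(1) val[OF that] that beats unfolding stacked_cycles_def by blast
  ultimately show ?thesis unfolding stacked_cycles_def by blast
qed

text \<open>A position of value 1 beats only within its own factor. Hence each 1 lies on the side of
  the 0 it beats in its cycle, and each 1 of \<open>A\<close> on the side of every 0 of
  \<open>B\<close>; these links connect all eight positions.\<close>

lemma stacked_cycles_tensor_same_side:
  assumes f: "f \<in> bool_funs n" and g: "g \<in> bool_funs m"
    and st: "stacked_cycles (n + m) (tensor_fun n m f g) A B"
  shows "A \<union> B \<subseteq> {..<n} \<or> A \<union> B \<subseteq> (+) n ` {..<m}"
proof -
  let ?h = "tensor_fun n m f g"
  define v where "v x = ?h (bits (n + m) {x})" for x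
  have v: "v x = 0 \<or> v x = 1" for x
    unfolding v_def by (rule bool_fun_01[OF tensor_fun_in_bool_funs[OF f g]]) simp
  have side: "x < n \<longleftrightarrow> y < n" if b: "beats (n + m) ?h x y" "v x = 1" for x y
  proof (rule ccontr)
    assume "(x < n) \<noteq> (y < n)"
    then consider y' where "x < n" "y = n + y'" | x' where "y < n" "x = n + x'"
      by (metis le_Suc_ex not_less)
    then show False
    proof cases
      case 1
      then show False
        using b tensor_fun_bits_left[OF f g, of "{x}"] tensor_fun_bits_right[OF f g, of "{y'}"]
          beats_tensor_cross(1)[OF f g, of x y']
        by (auto simp: v_def beats_def)
    next
      case 2
      then show False
        using b tensor_fun_bits_left[OF f g, of "{y}"] tensor_fun_bits_right[OF f g, of "{x'}"]
          beats_tensor_cross(2)[OF f g, of y x']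
        by (auto simp: v_def beats_def)
    qed
  qed
  obtain a b c d where A: "A = {a, b, c, d}" "beats (n + m) ?h a b" "beats (n + m) ?h b c"
      "beats (n + m) ?h c d" "beats (n + m) ?h d a"
    using st unfolding stacked_cycles_def beat_cycle_def by auto
  obtain a' b' c' d' where B: "B = {a', b', c', d'}" "beats (n + m) ?h a' b'" "beats (n + m) ?h b' c'"
      "beats (n + m) ?h c' d'" "beats (n + m) ?h d' a'"
    using st unfolding stacked_cycles_def beat_cycle_def by auto
  have ne: "v x \<noteq> v y" if "beats (n + m) ?h x y" for x y
    using that by (simp add: beats_def v_def)
  have cross: "x < n \<longleftrightarrow> y < n" if "x \<in> A" "y \<in> B" "v x = 1" "v y = 0" for x y
    using st that by (intro side) (auto simp: stacked_cycles_def v_def)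
  have vA: "v b = 1 - v a" "v c = v a" "v d = 1 - v a"
    using A(2-5) ne v by (smt (verit))+
  have vB: "v b' = 1 - v a'" "v c' = v a'" "v d' = 1 - v a'"
    using B(2-5) ne v by (smt (verit))+
  have mem: "a \<in> A" "b \<in> A" "c \<in> A" "d \<in> A" "a' \<in> B" "b' \<in> B" "c' \<in> B" "d' \<in> B"
    using A(1) B(1) by simp_all
  note sides = side[OF A(2)] side[OF A(3)] side[OF A(4)] side[OF A(5)]
    side[OF B(2)] side[OF B(3)] side[OF B(4)] side[OF B(5)]
  have same: "(b < n \<longleftrightarrow> a < n) \<and> (c < n \<longleftrightarrow> a < n) \<and> (d < n \<longleftrightarrow> a < n) \<and> (a' < n \<longleftrightarrow> a < n) \<and>
      (b' < n \<longleftrightarrow> a < n) \<and> (c' < n \<longleftrightarrow> a < n) \<and> (d' < n \<longleftrightarrow> a < n)"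
  \<comment> \<open>Values alternate, so the four cases fix which positions have value 1. In each,
    the links within the cycles and three links from \<open>A\<close> to \<open>B\<close>
    suffice.\<close>
  proof (cases "v a = 1")
    case a: True
    show ?thesis
    proof (cases "v a' = 1")
      case True
      show ?thesis
        using a True vA vB sides cross[OF mem(1,6)] cross[OF mem(1,8)] cross[OF mem(3,6)] by simp
    next
      case False
      then have "v a' = 0" using v[of a'] by simp
      then show ?thesis
        using a vA vB sides cross[OF mem(1,5)] cross[OF mem(1,7)] cross[OF mem(3,5)] by simp
    qed
  next
    case False
    then have a: "v a = 0" using v[of a] by simp
    show ?thesis
    proof (cases "v a' = 1")
      case True
      show ?thesis
        using a True vA vB sides cross[OF mem(2,6)] cross[OF mem(2,8)] cross[OF mem(4,6)] by simp
    next
      case False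
      then have "v a' = 0" using v[of a'] by simp
      then show ?thesis
        using a vA vB sides cross[OF mem(2,5)] cross[OF mem(2,7)] cross[OF mem(4,5)] by simp
    qed
  qed
  have "x < n \<longleftrightarrow> a < n" if "x \<in> A \<union> B" for x
    using that same unfolding A(1) B(1) by blast
  moreover have "A \<union> B \<subseteq> {..<n + m}"
    using st beat_cycle_subset unfolding stacked_cycles_def by blast
  moreover have "x \<in> (+) n ` {..<m}" if "\<not> x < n" "x < n + m" for x
    using that by (intro image_eqI[of _ _ "x - n"]) auto
  ultimately show ?thesis by blast
qed

text \<open>Each rule traces a stacked pair back to a premise: duality keeps beating, permutations
  relabel it, and a tensor product confines the pair to one factor. A function of one position has
  no two values to compare.\<close>

lemma no_stacked_cycles: "type_fun n f \<Longrightarrow> \<not> stacked_cycles n f A B"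
proof (induction arbitrary: A B rule: type_fun.induct)
  case one
  then show ?case by (auto simp: stacked_cycles_def beat_cycle_def beats_def)
next
  case (dual n f)
  show ?case
  proof
    assume st: "stacked_cycles n (dual_fun n f) A B"
    then have "A \<union> B \<subseteq> {..<n}" using beat_cycle_subset unfolding stacked_cycles_def by blast
    then have "stacked_cycles n f (id ` A) (id ` B)"
      by (intro stacked_cycles_image[OF st]) (auto simp: subset_iff beats_dual dual_fun_bits)
    then show False using dual.IH by blast
  qed
next
  case (perm n f \<sigma>)
  show ?case
  proof
    assume st: "stacked_cycles n (perm_fun n \<sigma> f) A B"
    have "stacked_cycles n f (\<sigma> ` A) (\<sigma> ` B)"
      by (rule stacked_cycles_image[OF st]) (auto simp: beats_perm perm(2) perm_fun_bits)
    then show False using perm.IH by blast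
  qed
next
  case (tensor n f m g)
  have f: "f \<in> bool_funs n" and g: "g \<in> bool_funs m"
    using tensor type_fun_bool_funs by auto
  show ?case
  proof
    assume st: "stacked_cycles (n + m) (tensor_fun n m f g) A B"
    from stacked_cycles_tensor_same_side[OF f g st] show False
    proof
      assume "A \<union> B \<subseteq> {..<n}"
      then have "stacked_cycles n f (id ` A) (id ` B)"
        by (intro stacked_cycles_image[OF st])
          (auto simp: beats_tensor_left[OF f g] tensor_fun_bits_left[OF f g] subset_iff)
      then show False using tensor.IH by blast
    next
      assume sub: "A \<union> B \<subseteq> (+) n ` {..<m}"
      have val: "tensor_fun n m f g (bits (n + m) {n + x}) = g (bits m {x})" for x
        using tensor_fun_bits_right[OF f g, of "{x}"] by simp
      have "stacked_cycles m g ((\<lambda>x. x - n) ` A) ((\<lambda>x. x - n) ` B)"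
      proof (rule stacked_cycles_image[OF st])
        show "beats m g (x - n) (y - n) \<longleftrightarrow> beats (n + m) (tensor_fun n m f g) x y"
          if "x \<in> A \<union> B" "y \<in> A \<union> B" for x y
          using subsetD[OF sub that(1)] subsetD[OF sub that(2)]
          by (auto simp: beats_tensor_right[OF f g])
        show "tensor_fun n m f g (bits (n + m) {x}) \<noteq> tensor_fun n m f g (bits (n + m) {y})"
          if "x \<in> A" "y \<in> B" "g (bits m {x - n}) \<noteq> g (bits m {y - n})" for x y
          using subsetD[OF sub, of x] subsetD[OF sub, of y] that by (auto simp: val)
      qed
      then show False using tensor.IH by blast
    qed
  qed
qed

text \<open>A 1 in the left block makes the right block irrelevant, so a left position determines
  the value of any pair it forms with a right one.\<close>

lemma stacked_cycles_causal_prod: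
  assumes f: "f \<in> bool_funs n" and A: "beat_cycle n f A" and B: "beat_cycle m g B"
  shows "stacked_cycles (n + m) (causal_prod n m f g) A ((+) n ` B)"
proof -
  let ?h = "causal_prod n m f g"
  note sub = beat_cycle_subset[OF A] beat_cycle_subset[OF B]
  have "beat_cycle (n + m) ?h (id ` A)"
    by (rule beat_cycle_image[OF A]) (use sub in \<open>auto simp: subset_iff beats_causal_left[OF f]\<close>)
  moreover have "beat_cycle (n + m) ?h ((+) n ` B)"
    by (rule beat_cycle_image[OF B]) (simp add: beats_causal_right[OF f])
  moreover have "beats (n + m) ?h x (n + y)"
    if "x \<in> A" "y \<in> B" "?h (bits (n + m) {x}) \<noteq> ?h (bits (n + m) {n + y})" for x y
  proof -
    have eq: "{x, n + y} = {x} \<union> (+) n ` {y}" by auto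
    have "?h (bits (n + m) {x, n + y}) = f (bits n {x})"
      unfolding eq by (rule causal_prod_bits_left[OF f]) (use that sub in auto)
    moreover have "?h (bits (n + m) {x}) = f (bits n {x})"
      using causal_prod_bits_left[OF f, of "{x}" m g "{}"] that sub by auto
    ultimately show ?thesis using that sub by (auto simp: beats_def)
  qed
  ultimately show ?thesis unfolding stacked_cycles_def by auto
qed

section \<open>Chain types and their causal products\<close>

lemma chain_type_iff_ranked: "type_fun n f \<Longrightarrow> chain_type n f \<longleftrightarrow> (\<exists>r. ranked n f r)"
  using chain_type_imp_ranked ranked_imp_chain_type by blast

theorem proposition3p6:
  fixes f g :: "bool list \<Rightarrow> int" and n m :: nat
  assumes "type_fun n f" and "type_fun m g"
  shows "(type_fun (n + m) (causal_prod n m f g) \<longleftrightarrow> chain_type n f \<or> chain_type m g) \<and>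
    (chain_type n f \<and> chain_type m g \<longrightarrow> chain_type (n + m) (causal_prod n m f g))"
proof -
  have f: "f \<in> bool_funs n" and g: "g \<in> bool_funs m" using assms type_fun_bool_funs by auto
  have type: "type_fun (n + m) (causal_prod n m f g)" if "chain_type n f \<or> chain_type m g"
    using that assms f g chain_type_imp_ranked type_fun_causal_prod_left type_fun_causal_prod_right
    by metis
  \<comment> \<open>If both failed, each factor would have a cycle, and the two would be stacked in
    a type function.\<close>
  have "chain_type n f \<or> chain_type m g" if "type_fun (n + m) (causal_prod n m f g)"
    using ranked_or_beat_cycle[OF assms(1)] ranked_or_beat_cycle[OF assms(2)]
      stacked_cycles_causal_prod[OF f] no_stacked_cycles[OF that]
    by (metis assms chain_type_iff_ranked)
  \<comment> \<open>The product is a type function by \<open>type\<close>, and the combined rank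
    makes it a chain type.\<close>
  moreover have "chain_type (n + m) (causal_prod n m f g)" if "chain_type n f" "chain_type m g"
    using that type ranked_causal_prod[OF f] chain_type_imp_ranked ranked_imp_chain_type by metis
  ultimately show ?thesis using type by blast
qed

end
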